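(* Let $\kappa\ge 0$, $H>0$ and $\eta\in(0,1)$ be given. Then, under the change of variables $x=\mathbf{x}(s,\theta,\varphi)$, for all $(x,x')\in A_\eta^H$, for all $n\in\mathbb{N}_0$, and for each choice $\xi=s$, $\xi=\theta$ and $\xi=\varphi$, we have $$\left|\frac{\partial^n g_S}{\partial \xi^n}\right|\le M(\eta,n)\,\max\{(\kappa H)^n,1\},$$ where $g_S=g_S(\mathbf{x}(s,\theta,\varphi),x')$ and where $M(\eta,n)$ is a real constant that depends on $\eta$ and $n$ but is independent of $H$.
   Context: $|\cdot|$ is the Euclidean norm on $\mathbb{R}^3$, $\mathbb{N}_0=\{0,1,2,\dots\}$, $\imath$ is the imaginary unit, and $\kappa\ge 0$ is the wavenumber. For $H>0$ the source box of side $H$ centered at the origin $x_S=0$ is $B(0,H)=[-H/2,H/2)^3$, and $h=\max_{x\in B(0,H)}|x|=\frac{\sqrt3}{2}H$. For $0<\eta<1$, $A_\eta^H=\{(x,x')\in\mathbb{R}^3\times B(0,H):|x'|\le\eta|x|\}$. Change of variables: $s=h/r$ with $r=|x|>0$, and $x=\mathbf{x}(s,\theta,\varphi)=\frac{h}{s}(\sin\theta\cos\varphi,\sin\theta\sin\varphi,\cos\theta)^T$ (so only points $x\neq0$, $s\in(0,\infty)$, are considered). Derivatives with respect to $\xi\in\{s,\theta,\varphi\}$ are partial derivatives of the composed function of $(s,\theta,\varphi)$ with $x'$ fixed. The analytic factor is $g_S(x,x')=\frac{|x|}{|x-x'|}\,e^{\imath\kappa(|x-x'|-|x|)}$; it satisfies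 $G(x,x')=G(x,0)g_S(x,x')$ for the Helmholtz Green function $G(x,x')=\frac{e^{\imath\kappa|x-x'|}}{4\pi|x-x'|}$. *)

theory Defs
  imports "HOL-Analysis.Analysis"
begin

definition source_box :: "real \<Rightarrow> (real^3) set" where
  "source_box H = {x. \<forall>i. - H / 2 \<le> x $ i \<and> x $ i < H / 2}"

text \<open>The supremum below is a maximum, attained at the corner with all coordinates \<open>- H / 2\<close>;
  see \<open>box_radius_attained\<close> and \<open>box_radius_eq\<close>.\<close>

definition box_radius :: "real \<Rightarrow> real" where
  "box_radius H = (SUP x\<in>source_box H. norm x)"

definition admissible :: "real \<Rightarrow> real \<Rightarrow> ((real^3) \<times> (real^3)) set" where
  "admissible \<eta> H = {(x, x'). x' \<in> source_box H \<and> norm x' \<le> \<eta> * norm x}"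

definition sph_point :: "real \<Rightarrow> real \<Rightarrow> real \<Rightarrow> real \<Rightarrow> real^3" where
  "sph_point H s \<theta> \<phi> =
     (box_radius H / s) *\<^sub>R vector [sin \<theta> * cos \<phi>, sin \<theta> * sin \<phi>, cos \<theta>]"

definition analytic_factor :: "real \<Rightarrow> real^3 \<Rightarrow> real^3 \<Rightarrow> complex" where
  "analytic_factor \<kappa> x x' =
     complex_of_real (norm x / norm (x - x'))
       * exp (\<i> * complex_of_real (\<kappa> * (norm (x - x') - norm x)))"

text \<open>Derivatives of order \<open>n\<close> of a complex-valued function of one real variable.
  Since \<^const>\<open>vector_derivative\<close> is a total operator, \<open>nth_deriv\<close> is only meaningful in
  conjunction with \<open>times_differentiable_at\<close>, which says that the derivatives of orders
  \<open>1, \<dots>, n\<close> exist in a neighbourhood of the point.\<close>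

definition nth_deriv :: "nat \<Rightarrow> (real \<Rightarrow> complex) \<Rightarrow> real \<Rightarrow> complex" where
  "nth_deriv n f = ((\<lambda>g t. vector_derivative g (at t)) ^^ n) f"

definition times_differentiable_at :: "nat \<Rightarrow> (real \<Rightarrow> complex) \<Rightarrow> real \<Rightarrow> bool" where
  "times_differentiable_at n f t \<longleftrightarrow>
     (\<forall>k<n. \<forall>\<^sub>F u in nhds t. nth_deriv k f differentiable (at u))"

lemma norm_source_box_le:
  assumes "x \<in> source_box H"
  shows "norm x \<le> sqrt 3 / 2 * H"
proof -
  have *: "\<bar>x $ i\<bar> \<le> H / 2" for i
    using assms unfolding source_box_def by (auto simp: abs_le_iff minus_le_iff dest!: spec[of _ i])
  then have H: "0 \<le> H / 2" using abs_ge_zero order_trans by blast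
  have "(norm x)\<^sup>2 = (\<Sum>i\<in>UNIV. (x $ i)\<^sup>2)"
    by (simp add: norm_vec_def L2_set_def sum_nonneg)
  also have "\<dots> \<le> (\<Sum>i\<in>(UNIV::3 set). (H / 2)\<^sup>2)"
    by (intro sum_mono) (metis * H abs_le_square_iff abs_of_nonneg)
  also have "\<dots> = (sqrt 3 / 2 * H)\<^sup>2" by (simp add: power_mult_distrib power_divide)
  finally show ?thesis
    by (rule power2_le_imp_le) (use H in simp)
qed

lemma norm_source_box_corner:
  assumes "0 < H"
  shows "(\<chi> i. - H / 2) \<in> source_box H" "norm (\<chi> i. - H / 2 :: real^3) = sqrt 3 / 2 * H"
proof -
  show "(\<chi> i. - H / 2) \<in> source_box H" using assms by (simp add: source_box_def)
  have "norm (\<chi> i. - H / 2 :: real^3) = sqrt (3 * (H / 2)\<^sup>2)"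
    by (simp add: norm_vec_def L2_set_def power_divide)
  also have "\<dots> = sqrt 3 / 2 * H"
    using assms by (simp only: real_sqrt_mult real_sqrt_abs)
  finally show "norm (\<chi> i. - H / 2 :: real^3) = sqrt 3 / 2 * H" .
qed

lemma box_radius_eq:
  assumes "0 < H"
  shows "box_radius H = sqrt 3 / 2 * H"
  unfolding box_radius_def
proof (rule cSup_eq_maximum)
  show "sqrt 3 / 2 * H \<in> norm ` source_box H"
    using norm_source_box_corner[OF assms] by (metis image_eqI)
qed (use norm_source_box_le in auto)

lemma box_radius_attained:
  assumes "0 < H"
  shows "box_radius H \<in> norm ` source_box H"
  using norm_source_box_corner[OF assms] box_radius_eq[OF assms] by (metis image_eqI)

end

theory Submission
  imports Defs "HOL-Complex_Analysis.Cauchy_Integral_Formula"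
begin

text \<open>Writing \<open>x' = h y\<close> and \<open>x = (h/s) e\<close> with a unit vector \<open>e\<close>, put
  \<open>p = s |y|\<^sup>2 - 2 e \<bullet> y\<close> and \<open>q = 1 + s p = |e - s y|\<^sup>2\<close>. Then the analytic factor is
  \<open>exp (\<i> \<kappa> h p / (1 + \<surd>q)) / \<surd>q\<close>. In each of the three variables \<open>p\<close> and \<open>q\<close> extend to
  entire functions, and \<open>q \<ge> (1 - \<eta>)\<^sup>2\<close> on the real axis, so the factor extends holomorphically
  to a disc whose radius \<open>\<rho>\<close> depends on \<open>\<eta>\<close> only. The phase \<open>p / (1 + \<surd>q)\<close> is real at the centre
  and Lipschitz, so on the smaller disc of radius \<open>\<rho> / max (\<kappa> H) 1\<close> the exponential is
  bounded in terms of \<open>\<eta>\<close> alone. Cauchy's inequality on that disc gives the claim.\<close>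

section \<open>The phase factor and the principal square root\<close>

text \<open>For \<open>q = 1 + s * p\<close> the phase \<open>(csqrt q - 1) / s\<close> is
  rationalised to \<open>p / (1 + csqrt q)\<close>, so that no division by \<open>s\<close>
  remains.\<close>

definition phase_factor :: "real \<Rightarrow> complex \<Rightarrow> complex \<Rightarrow> complex" where
  "phase_factor c p q = exp (\<i> * of_real c * (p / (1 + csqrt q))) / csqrt q"

lemma one_le_norm_one_plus_csqrt: "1 \<le> norm (1 + csqrt z)"
proof -
  have "1 \<le> Re (1 + csqrt z)" using Re_csqrt[of z] by simp
  also have "\<dots> \<le> norm (1 + csqrt z)" by (rule complex_Re_le_cmod)
  finally show ?thesis .
qed

text \<open>Difference of squares: \<open>csqrt z\<close> has nonnegative real part, so the cofactor
  \<open>csqrt z + sqrt a\<close> has modulus at least \<open>sqrt a\<close>.\<close>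

lemma norm_csqrt_diff_le:
  assumes "0 < a"
  shows "norm (csqrt z - csqrt (of_real a)) \<le> norm (z - of_real a) / sqrt a"
proof -
  let ?w = "csqrt z" and ?b = "complex_of_real (sqrt a)"
  have b: "csqrt (of_real a) = ?b" using assms by (simp add: csqrt_of_real)
  have bb: "?b * ?b = of_real a"
    using assms by (metis abs_of_pos of_real_mult real_sqrt_mult_self)
  have "z - of_real a = (?w - ?b) * (?w + ?b)"
    using power2_csqrt[of z] bb by (simp add: power2_eq_square algebra_simps)
  then have "norm (z - of_real a) = norm (?w - ?b) * norm (?w + ?b)" by (simp add: norm_mult)
  moreover have "sqrt a \<le> norm (?w + ?b)"
    using complex_Re_le_cmod[of "?w + ?b"] Re_csqrt[of z] by (simp del: csqrt.simps)
  ultimately have "norm (?w - ?b) * sqrt a \<le> norm (z - of_real a)"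
    by (simp add: mult_left_mono)
  then show ?thesis using assms b by (simp add: pos_le_divide_eq)
qed

text \<open>Positivity of \<open>Re (q z)\<close> keeps \<open>q\<close> off the branch cut of
  \<open>csqrt\<close> and away from its zero; \<open>1 + csqrt w\<close> never vanishes.\<close>

lemma phase_factor_holomorphic_on:
  assumes "p holomorphic_on A" "q holomorphic_on A" "\<And>z. z \<in> A \<Longrightarrow> 0 < Re (q z)"
  shows "(\<lambda>z. phase_factor c (p z) (q z)) holomorphic_on A"
proof -
  have "q z \<notin> \<real>\<^sub>\<le>\<^sub>0" if "z \<in> A" for z
    using assms(3)[OF that] by (auto simp: complex_nonpos_Reals_iff)
  moreover have "csqrt (q z) \<noteq> 0" if "z \<in> A" for z
    using assms(3)[OF that] by auto
  moreover have "1 + csqrt w \<noteq> 0" for w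
    using one_le_norm_one_plus_csqrt[of w] by auto
  ultimately show ?thesis
    unfolding phase_factor_def using assms(1,2) by (intro holomorphic_intros) auto
qed

text \<open>Both denominators have modulus at least 1, so only numerators count once the difference
  is split; \<open>1 / \<delta>\<close> comes from the Lipschitz bound \<open>1 / sqrt q0\<close>
  for the root.\<close>

lemma norm_phase_diff_le:
  fixes p q :: complex and p0 q0 :: real
  assumes "0 < \<delta>" "\<delta>\<^sup>2 \<le> q0"
  shows "norm (p / (1 + csqrt q) - of_real p0 / (1 + csqrt (of_real q0)))
           \<le> norm (p - of_real p0) + \<bar>p0\<bar> * norm (q - of_real q0) / \<delta>"
proof -
  let ?u = "1 + csqrt q" and ?v = "1 + csqrt (of_real q0)"
  have q0: "0 < q0" using assms by (meson less_le_trans zero_less_power)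
  have uv: "1 \<le> norm ?u" "1 \<le> norm ?v" by (rule one_le_norm_one_plus_csqrt)+
  then have nz: "?u \<noteq> 0" "?v \<noteq> 0" by auto
  have le: "norm (w / z) \<le> norm w" if "1 \<le> norm z" for w z :: complex
    using that by (simp add: norm_divide divide_le_eq mult_le_cancel_left1)
  have "norm (csqrt q - csqrt (of_real q0)) \<le> norm (q - of_real q0) / sqrt q0"
    by (rule norm_csqrt_diff_le[OF q0])
  also have "\<dots> \<le> norm (q - of_real q0) / \<delta>"
    using assms q0 by (intro divide_left_mono) (auto intro: real_le_rsqrt)
  finally have sq: "norm (csqrt q - csqrt (of_real q0)) \<le> norm (q - of_real q0) / \<delta>" .
  have "a / u - b / v = (a - b) / u - b * (u - v) / (u * v)" if "u \<noteq> 0" "v \<noteq> 0" for a b u v :: complex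
    using that by (simp add: field_simps)
  from this[OF nz] have "p / ?u - of_real p0 / ?v =
      (p - of_real p0) / ?u - of_real p0 * (csqrt q - csqrt (of_real q0)) / (?u * ?v)"
    by simp
  also have "norm \<dots> \<le> norm ((p - of_real p0) / ?u) +
      norm (of_real p0 * (csqrt q - csqrt (of_real q0)) / (?u * ?v))"
    by (rule norm_triangle_ineq4)
  also have "\<dots> \<le> norm (p - of_real p0) + norm (of_real p0 * (csqrt q - csqrt (of_real q0)))"
  proof (intro add_mono le uv)
    show "1 \<le> norm (?u * ?v)" using uv mult_mono[OF uv] by (simp add: norm_mult)
  qed
  also have "\<dots> \<le> norm (p - of_real p0) + \<bar>p0\<bar> * (norm (q - of_real q0) / \<delta>)"
    using mult_left_mono[OF sq, of "\<bar>p0\<bar>"] by (simp add: norm_mult)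
  finally show ?thesis by simp
qed

section \<open>Cauchy estimate for the phase factor\<close>

text \<open>\<open>m\<close> stands for \<open>max (\<kappa> * H) 1\<close>. Shrinking the disc by
  \<open>m\<close> makes the bound on the exponential free of \<open>m\<close>, at the price of the
  factor \<open>m ^ n\<close> in Cauchy's inequality.\<close>

lemma phase_factor_derivative_bound:
  fixes p q :: "complex \<Rightarrow> complex" and p0 q0 \<xi> :: real
  assumes hol: "p holomorphic_on UNIV" "q holomorphic_on UNIV"
    and real: "p (of_real \<xi>) = of_real p0" "q (of_real \<xi>) = of_real q0"
    and \<delta>: "0 < \<delta>" "\<delta> \<le> 1" "\<delta>\<^sup>2 \<le> q0" and K: "1 \<le> K" "\<bar>p0\<bar> \<le> K"
    and lip: "\<And>z. z \<in> cball (of_real \<xi>) 1 \<Longrightarrow> norm (p z - p (of_real \<xi>)) \<le> K * norm (z - of_real \<xi>)"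
      "\<And>z. z \<in> cball (of_real \<xi>) 1 \<Longrightarrow> norm (q z - q (of_real \<xi>)) \<le> K * norm (z - of_real \<xi>)"
    and c: "0 \<le> c" "c \<le> m" "1 \<le> m"
  defines "\<rho> \<equiv> \<delta>\<^sup>2 / (2 * K)" and "F \<equiv> \<lambda>z. phase_factor c (p z) (q z)"
  shows "F holomorphic_on ball (of_real \<xi>) \<rho>"
    and "norm ((deriv ^^ n) F (of_real \<xi>)) \<le>
           fact n * (2 / \<delta> * exp (K + K * K / \<delta>)) / (\<rho> / m) ^ n"
proof -
  define r where "r = \<rho> / m"
  have "\<delta>\<^sup>2 \<le> 1" using \<delta> by (simp add: power_le_one)
  then have \<rho>: "0 < \<rho>" "\<rho> \<le> 1" using \<delta> K by (auto simp: \<rho>_def divide_simps)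
  have r: "0 < r" "r \<le> \<rho>" "m * r = \<rho>"
    using \<rho> c by (auto simp: r_def divide_simps mult_le_cancel_left1)
  \<comment> \<open>\<open>K * \<rho>\<close> is half of the lower bound
    \<open>\<delta>\<^sup>2\<close> for \<open>q0\<close>, so \<open>Re (q z)\<close> keeps the
    other half.\<close>
  have q_near: "norm (q z - of_real q0) \<le> \<delta>\<^sup>2 / 2" if "z \<in> cball (of_real \<xi>) \<rho>" for z
  proof -
    have "norm (z - of_real \<xi>) \<le> \<rho>"
      using that by (simp add: dist_norm norm_minus_commute)
    moreover have "z \<in> cball (of_real \<xi>) 1" using that \<rho> by auto
    ultimately have "norm (q z - of_real q0) \<le> K * \<rho>"
      using lip(2)[of z] K real by (smt (verit) mult_left_mono)
    then show ?thesis using K by (simp add: \<rho>_def)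
  qed
  have q_Re: "\<delta>\<^sup>2 / 2 \<le> Re (q z)" if "z \<in> cball (of_real \<xi>) \<rho>" for z
    using q_near[OF that] abs_Re_le_cmod[of "q z - of_real q0"] \<delta> by auto
  have "Re (q z) > 0" if "z \<in> cball (of_real \<xi>) \<rho>" for z
    using q_Re[OF that] \<delta> by (smt (verit) half_gt_zero zero_less_power)
  then have F_hol: "F holomorphic_on cball (of_real \<xi>) \<rho>"
    unfolding F_def by (intro phase_factor_holomorphic_on holomorphic_on_subset[OF hol(1)]
        holomorphic_on_subset[OF hol(2)]) auto
  then show "F holomorphic_on ball (of_real \<xi>) \<rho>"
    by (rule holomorphic_on_subset) auto
  have F_le: "norm (F z) \<le> 2 / \<delta> * exp (K + K * K / \<delta>)" if "norm (of_real \<xi> - z) = r" for z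
  proof -
    have z: "norm (z - of_real \<xi>) = r" using that by (simp add: norm_minus_commute)
    have zin: "z \<in> cball (of_real \<xi>) \<rho>" "z \<in> cball (of_real \<xi>) 1"
      using that r \<rho> by (auto simp: dist_norm)
    let ?\<psi> = "p z / (1 + csqrt (q z))"
    let ?\<chi> = "of_real p0 / (1 + csqrt (of_real q0))"
    \<comment> \<open>The phase at the centre is real, so the imaginary part at \<open>z\<close> is
      at most the distance between the two phases.\<close>
    have "0 \<le> q0" using \<delta>(3) zero_le_power2[of \<delta>] by linarith
    then have "?\<chi> = of_real (p0 / (1 + sqrt q0))"
      by (simp add: csqrt_of_real)
    then have "Im ?\<chi> = 0" by (metis Im_complex_of_real)
    then have "\<bar>Im ?\<psi>\<bar> \<le> norm (?\<psi> - ?\<chi>)"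
      using abs_Im_le_cmod[of "?\<psi> - ?\<chi>"] by simp
    also have "\<dots> \<le> norm (p z - of_real p0) + \<bar>p0\<bar> * norm (q z - of_real q0) / \<delta>"
      by (rule norm_phase_diff_le[OF \<delta>(1,3)])
    also have "\<dots> \<le> K * r + K * (K * r) / \<delta>"
      using lip[OF zin(2)] real z K \<delta>
      by (intro add_mono divide_right_mono mult_mono) auto
    also have "\<dots> = (K + K * K / \<delta>) * r" by (simp add: algebra_simps)
    finally have Im: "\<bar>Im ?\<psi>\<bar> \<le> (K + K * K / \<delta>) * r" .
    have L: "0 \<le> K + K * K / \<delta>" using K \<delta> by simp
    \<comment> \<open>The large parameter cancels: \<open>c \<le> m\<close> and
      \<open>m * r = \<rho> \<le> 1\<close>.\<close>
    have "- (c * Im ?\<psi>) \<le> c * \<bar>Im ?\<psi>\<bar>"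
      using c(1) by (metis abs_ge_minus_self mult_left_mono mult_minus_right)
    also have "\<dots> \<le> m * ((K + K * K / \<delta>) * r)"
      using Im c by (intro mult_mono) auto
    also have "\<dots> = (K + K * K / \<delta>) * \<rho>" using r(3) by (simp add: mult.left_commute)
    also have "\<dots> \<le> K + K * K / \<delta>" using L \<rho> by (simp add: mult_left_le)
    finally have e: "exp (- (c * Im ?\<psi>)) \<le> exp (K + K * K / \<delta>)" by simp
    \<comment> \<open>The modulus of \<open>csqrt\<close> is the root of the modulus;
      \<open>\<delta> / 2\<close> replaces the sharper \<open>\<delta> / sqrt 2\<close>.\<close>
    have "(\<delta> / 2)\<^sup>2 \<le> \<delta>\<^sup>2 / 2" by (simp add: power_divide)
    also have "\<dots> \<le> norm (q z)" using q_Re[OF zin(1)] complex_Re_le_cmod order_trans by blast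
    finally have "\<delta> / 2 \<le> norm (csqrt (q z))" unfolding norm_csqrt by (rule real_le_rsqrt)
    then have "exp (- (c * Im ?\<psi>)) / norm (csqrt (q z)) \<le> exp (K + K * K / \<delta>) / (\<delta> / 2)"
      using e \<delta> by (intro frac_le) auto
    moreover have "norm (exp (\<i> * of_real c * w)) = exp (- (c * Im w))" for w
      by simp
    ultimately show ?thesis
      unfolding F_def phase_factor_def norm_divide by (simp only:) (simp add: mult.commute)
  qed
  show "norm ((deriv ^^ n) F (of_real \<xi>)) \<le>
      fact n * (2 / \<delta> * exp (K + K * K / \<delta>)) / (\<rho> / m) ^ n"
    unfolding r_def[symmetric]
  proof (rule Cauchy_inequality)
    have "cball (of_real \<xi>) r \<subseteq> cball (complex_of_real \<xi>) \<rho>"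
      by (rule subset_cball[OF r(2)])
    then have "F holomorphic_on cball (of_real \<xi>) r"
      using F_hol holomorphic_on_subset by blast
    then show "continuous_on (cball (of_real \<xi>) r) F" "F holomorphic_on ball (of_real \<xi>) r"
      by (auto intro: holomorphic_on_imp_continuous_on holomorphic_on_subset)
  qed (use r F_le in auto)
qed

section \<open>From complex to real derivatives\<close>

text \<open>The induction carries equality on a neighbourhood, since equality at
  \<open>\<xi>\<close> alone says nothing about the next derivative. Its step yields
  \<open>has_vector_derivative\<close>, so the total \<open>vector_derivative\<close> returns a
  genuine value.\<close>

lemma nth_deriv_of_real_restriction:
  assumes hol: "F holomorphic_on S" "open S" and \<xi>: "of_real \<xi> \<in> S"
    and eq: "\<forall>\<^sub>F t in nhds \<xi>. f t = F (of_real t)"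
  shows "\<forall>\<^sub>F t in nhds \<xi>. nth_deriv n f t = (deriv ^^ n) F (of_real t) \<and>
           nth_deriv n f differentiable (at t)"
proof -
  have "open (complex_of_real -` S)"
    using hol(2) by (intro open_vimage continuous_intros)
  then have S: "\<forall>\<^sub>F t in nhds \<xi>. complex_of_real t \<in> S"
    using \<xi> by (auto dest: eventually_nhds_in_open)
  have vd: "((\<lambda>t. (deriv ^^ n) F (of_real t)) has_vector_derivative (deriv ^^ Suc n) F (of_real t))
      (at t)" if "of_real t \<in> S" for n t
    using holomorphic_derivI[OF holomorphic_higher_deriv[OF hol] hol(2) that, of n UNIV]
    by (intro has_vector_derivative_real_field) (simp add: o_def)
  have step: "\<forall>\<^sub>F t in nhds \<xi>.
      (nth_deriv n f has_vector_derivative (deriv ^^ Suc n) F (of_real t)) (at t)"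
    if "\<forall>\<^sub>F t in nhds \<xi>. nth_deriv n f t = (deriv ^^ n) F (of_real t)" for n
  proof -
    \<comment> \<open>Equality near \<open>\<xi>\<close> is also equality near each \<open>t\<close>
      close to \<open>\<xi>\<close>, as needed to transfer a derivative at \<open>t\<close>.\<close>
    have "\<forall>\<^sub>F t in nhds \<xi>. \<forall>\<^sub>F u in nhds t. nth_deriv n f u = (deriv ^^ n) F (of_real u)"
      using that by (simp add: eventually_eventually)
    with S show ?thesis
    proof eventually_elim
      case (elim t)
      have "(nth_deriv n f has_vector_derivative (deriv ^^ Suc n) F (of_real t)) (at t) \<longleftrightarrow>
        ((\<lambda>t. (deriv ^^ n) F (of_real t)) has_vector_derivative (deriv ^^ Suc n) F (of_real t)) (at t)"
        using elim(2) eventually_nhds_x_imp_x[OF elim(2)]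
        by (intro has_vector_derivative_cong_ev) auto
      then show ?case using vd[OF elim(1)] by blast
    qed
  qed
  have "\<forall>\<^sub>F t in nhds \<xi>. nth_deriv n f t = (deriv ^^ n) F (of_real t)" for n
  proof (induction n)
    case 0
    then show ?case using eq by (simp add: nth_deriv_def)
  next
    case (Suc n)
    from step[OF Suc] show ?case
      by eventually_elim (simp add: nth_deriv_def vector_derivative_at)
  qed
  from this[of n] step[OF this[of n]] show ?thesis
    by eventually_elim (auto intro: differentiableI_vector)
qed

section \<open>The analytic factor in scaled coordinates\<close>

text \<open>The difference of the two points is
  \<open>(h / t) *\<^sub>R (e - t *\<^sub>R y)\<close>. If it vanishes, both sides are 0 because
  division by 0 gives 0, so the identity covers every positive \<open>t\<close>.\<close>

lemma analytic_factor_scaled: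
  fixes e y :: "real^3"
  assumes "norm e = 1" "0 < h" "0 < t"
  defines "p \<equiv> t * (norm y)\<^sup>2 - 2 * (e \<bullet> y)"
  shows "analytic_factor \<kappa> ((h / t) *\<^sub>R e) (h *\<^sub>R y) =
           phase_factor (\<kappa> * h) (of_real p) (of_real (1 + t * p))"
    and "(norm (e - t *\<^sub>R y))\<^sup>2 = 1 + t * p"
proof -
  let ?Q = "norm (e - t *\<^sub>R y)"
  show Q: "?Q\<^sup>2 = 1 + t * p"
    using assms(1) unfolding p_def power2_norm_eq_inner
    by (simp add: norm_eq_1 inner_diff inner_commute algebra_simps power2_eq_square)
  have sq: "csqrt (of_real (1 + t * p)) = of_real ?Q"
    unfolding Q[symmetric] by (simp add: csqrt_of_real del: of_real_power)
  have "(h / t) *\<^sub>R e - h *\<^sub>R y = (h / t) *\<^sub>R (e - t *\<^sub>R y)"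
    using assms by (simp add: algebra_simps)
  then have d: "norm ((h / t) *\<^sub>R e - h *\<^sub>R y) = h / t * ?Q"
    using assms by simp
  have nx: "norm ((h / t) *\<^sub>R e) = h / t" using assms by simp
  \<comment> \<open>Dividing by \<open>1 + ?Q\<close> exposes a factor \<open>t\<close>, which
    cancels the denominator of \<open>h / t\<close>.\<close>
  have "(?Q - 1) * (1 + ?Q) = t * p" using Q by (simp add: power2_eq_square algebra_simps)
  then have "?Q - 1 = t * p / (1 + ?Q)"
    by (metis add.commute add_nonneg_pos less_irrefl nonzero_eq_divide_eq norm_ge_zero zero_less_one)
  moreover have "h / t * ?Q - h / t = h / t * (?Q - 1)" by (simp add: algebra_simps)
  ultimately have phase: "\<kappa> * (h / t * ?Q - h / t) = \<kappa> * h * (p / (1 + ?Q))"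
    using assms by simp
  show "analytic_factor \<kappa> ((h / t) *\<^sub>R e) (h *\<^sub>R y) =
      phase_factor (\<kappa> * h) (of_real p) (of_real (1 + t * p))"
    unfolding analytic_factor_def phase_factor_def sq d nx phase
    using assms(2,3) by (simp add: mult.assoc)
qed

section \<open>Complex sine and cosine near the real axis\<close>

lemma norm_cos_le_exp_abs_Im: "norm (cos z) \<le> exp \<bar>Im z\<bar>" for z :: complex
proof -
  have "exp (- Im z) \<le> exp \<bar>Im z\<bar>" "exp (Im z) \<le> exp \<bar>Im z\<bar>" by auto
  then have "exp (- Im z) + exp (Im z) \<le> exp \<bar>Im z\<bar> * 2" by linarith
  then show ?thesis
    by (force simp: cos_exp_eq norm_divide intro: order_trans[OF norm_triangle_ineq])
qed

text \<open>Mean value bound: the centre is real, so \<open>\<bar>Im w\<bar> \<le> 1\<close> on the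
  disc and \<open>cos\<close> is bounded by \<open>exp 1 \<le> 3\<close>; the reflection
  \<open>pi / 2 - w\<close> gives the same for \<open>sin\<close>.\<close>

lemma norm_sin_cos_diff_le:
  fixes z :: complex and \<xi> :: real
  assumes "z \<in> cball (of_real \<xi>) 1"
  shows "norm (sin z - sin (of_real \<xi>)) \<le> 3 * norm (z - of_real \<xi>)"
    and "norm (cos z - cos (of_real \<xi>)) \<le> 3 * norm (z - of_real \<xi>)"
proof -
  have cos: "norm (cos w) \<le> 3" if "\<bar>Im w\<bar> \<le> 1" for w :: complex
    using norm_cos_le_exp_abs_Im[of w] exp_le that by (smt (verit) exp_le_cancel_iff)
  have Im: "\<bar>Im w\<bar> \<le> 1" if "w \<in> cball (of_real \<xi>) 1" for w
    using that abs_Im_le_cmod[of "of_real \<xi> - w"] by (simp add: dist_norm)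
  have sin: "norm (sin w) \<le> 3" if "\<bar>Im w\<bar> \<le> 1" for w :: complex
    using cos[of "of_real pi / 2 - w"] that by (simp add: sin_cos_eq)
  show "norm (sin z - sin (of_real \<xi>)) \<le> 3 * norm (z - of_real \<xi>)"
    by (rule field_differentiable_bound[where S = "cball (of_real \<xi>) 1" and f' = cos])
      (use assms cos Im in \<open>auto intro!: derivative_eq_intros\<close>)
  show "norm (cos z - cos (of_real \<xi>)) \<le> 3 * norm (z - of_real \<xi>)"
    by (rule field_differentiable_bound[where S = "cball (of_real \<xi>) 1" and f' = "\<lambda>w. - sin w"])
      (use assms sin Im in \<open>auto intro!: derivative_eq_intros\<close>)
qed

section \<open>Unit directions and the constant of the bound\<close>

definition unit_direction :: "real \<Rightarrow> real \<Rightarrow> real^3" where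
  "unit_direction \<theta> \<phi> = vector [sin \<theta> * cos \<phi>, sin \<theta> * sin \<phi>, cos \<theta>]"

lemma norm_unit_direction: "norm (unit_direction \<theta> \<phi>) = 1"
proof -
  have "(sin \<theta> * cos \<phi>)\<^sup>2 + (sin \<theta> * sin \<phi>)\<^sup>2 = (sin \<theta>)\<^sup>2 * ((sin \<phi>)\<^sup>2 + (cos \<phi>)\<^sup>2)"
    by (simp only: power_mult_distrib distrib_left add.commute)
  then have "(sin \<theta> * cos \<phi>)\<^sup>2 + (sin \<theta> * sin \<phi>)\<^sup>2 + (cos \<theta>)\<^sup>2 = 1"
    by (simp only: sin_cos_squared_add mult_1_right)
  then show ?thesis
    by (simp add: unit_direction_def norm_vec_def L2_set_def sum_3)
qed

lemma inner_unit_direction: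
  "unit_direction \<theta> \<phi> \<bullet> y = sin \<theta> * cos \<phi> * y $ 1 + sin \<theta> * sin \<phi> * y $ 2 + cos \<theta> * y $ 3"
  by (simp add: unit_direction_def inner_vec_def sum_3)

text \<open>The number \<open>24\<close> bounds \<open>|p|\<close> at the centre and the Lipschitz constants of \<open>p\<close> and \<open>q\<close> on the
  unit disc, for all three variables; the angular ones are the worst case.\<close>

definition derivative_bound :: "real \<Rightarrow> nat \<Rightarrow> real" where
  "derivative_bound \<eta> n =
     fact n * (2 / (1 - \<eta>) * exp (24 + 24 * 24 / (1 - \<eta>))) / ((1 - \<eta>)\<^sup>2 / (2 * 24)) ^ n"

lemma max_power_one: "0 \<le> a \<Longrightarrow> (max a 1) ^ n = max (a ^ n) (1 :: real)"
  by (smt (verit) max_def one_le_power power_le_one power_one)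

section \<open>Derivative bounds in one real variable\<close>

text \<open>The Cauchy bound with \<open>\<delta> = 1 - \<eta>\<close>, \<open>K = 24\<close> and
  \<open>m = max a 1\<close>, moved to the real line; \<open>a\<close> will be
  \<open>\<kappa> * H\<close>.\<close>

lemma phase_factor_real_derivatives:
  fixes p q :: "complex \<Rightarrow> complex" and p0 q0 \<xi> :: real
  assumes hol: "p holomorphic_on UNIV" "q holomorphic_on UNIV"
    and real: "p (of_real \<xi>) = of_real p0" "q (of_real \<xi>) = of_real q0"
    and \<eta>: "0 < \<eta>" "\<eta> < 1" "(1 - \<eta>)\<^sup>2 \<le> q0" and p0: "\<bar>p0\<bar> \<le> 24"
    and lip: "\<And>z. z \<in> cball (of_real \<xi>) 1 \<Longrightarrow> norm (p z - p (of_real \<xi>)) \<le> 24 * norm (z - of_real \<xi>)"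
      "\<And>z. z \<in> cball (of_real \<xi>) 1 \<Longrightarrow> norm (q z - q (of_real \<xi>)) \<le> 24 * norm (z - of_real \<xi>)"
    and c: "0 \<le> c" "c \<le> a"
    and f: "\<forall>\<^sub>F t in nhds \<xi>. f t = phase_factor c (p (of_real t)) (q (of_real t))"
  shows "times_differentiable_at n f \<xi> \<and> norm (nth_deriv n f \<xi>) \<le> derivative_bound \<eta> n * max (a ^ n) 1"
proof -
  let ?F = "\<lambda>z. phase_factor c (p z) (q z)"
  define \<rho> where "\<rho> = (1 - \<eta>)\<^sup>2 / (2 * 24)"
  have \<rho>: "0 < \<rho>" using \<eta> by (simp add: \<rho>_def)
  note bound = phase_factor_derivative_bound[OF hol real _ _ \<eta>(3) _ p0 lip c(1), of "max a 1"]
  have hol_F: "?F holomorphic_on ball (of_real \<xi>) \<rho>"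
    unfolding \<rho>_def by (rule bound) (use \<eta> c in auto)
  have "norm ((deriv ^^ n) ?F (of_real \<xi>)) \<le>
      fact n * (2 / (1 - \<eta>) * exp (24 + 24 * 24 / (1 - \<eta>))) / (\<rho> / max a 1) ^ n"
    unfolding \<rho>_def by (rule bound) (use \<eta> c in auto)
  also have "\<dots> = derivative_bound \<eta> n * max (a ^ n) 1"
    using c unfolding derivative_bound_def \<rho>_def[symmetric]
    by (simp add: power_divide max_power_one)
  finally have le: "norm ((deriv ^^ n) ?F (of_real \<xi>)) \<le> derivative_bound \<eta> n * max (a ^ n) 1" .
  have deriv: "\<forall>\<^sub>F t in nhds \<xi>. nth_deriv k f t = (deriv ^^ k) ?F (of_real t) \<and>
      nth_deriv k f differentiable (at t)" for k
    by (rule nth_deriv_of_real_restriction[OF hol_F]) (use \<rho> f in auto)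
  have "times_differentiable_at n f \<xi>"
    unfolding times_differentiable_at_def
  proof (intro allI impI)
    show "\<forall>\<^sub>F u in nhds \<xi>. nth_deriv k f differentiable (at u)" for k
      using deriv[of k] by (rule eventually_mono) (rule conjunct2)
  qed
  moreover have "nth_deriv n f \<xi> = (deriv ^^ n) ?F (of_real \<xi>)"
    using eventually_nhds_x_imp_x[OF deriv[of n]] by blast
  ultimately show ?thesis using le by simp
qed

text \<open>Serves both angles: in either one, \<open>e \<bullet> y\<close> is a combination of sine
  and cosine plus a constant.\<close>

lemma phase_factor_trig_derivatives:
  fixes \<alpha> \<beta> \<gamma> s Y \<xi> :: real
  defines "P \<equiv> \<lambda>t. s * Y\<^sup>2 - 2 * (\<alpha> * sin t + \<beta> * cos t + \<gamma>)"
  assumes \<eta>: "0 < \<eta>" "\<eta> < 1" and q0: "(1 - \<eta>)\<^sup>2 \<le> 1 + s * P \<xi>" and p0: "\<bar>P \<xi>\<bar> \<le> 24"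
    and Y: "Y \<le> 1" "0 < s" "s * Y \<le> \<eta>" and \<alpha>\<beta>: "\<bar>\<alpha>\<bar> \<le> 2 * Y" "\<bar>\<beta>\<bar> \<le> 2 * Y"
    and c: "0 \<le> c" "c \<le> a"
    and f: "\<And>t. f t = phase_factor c (of_real (P t)) (of_real (1 + s * P t))"
  shows "times_differentiable_at n f \<xi> \<and> norm (nth_deriv n f \<xi>) \<le> derivative_bound \<eta> n * max (a ^ n) 1"
proof -
  define p :: "complex \<Rightarrow> complex" where
    "p z = of_real (s * Y\<^sup>2) - 2 * (of_real \<alpha> * sin z + of_real \<beta> * cos z + of_real \<gamma>)" for z
  have p: "p (of_real t) = of_real (P t)" for t
    by (simp add: p_def P_def sin_of_real cos_of_real)
  \<comment> \<open>\<open>24\<close> is \<open>2 * (2 * 3 + 2 * 3)\<close>. The factor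
    \<open>Y\<close> is kept because \<open>s\<close> alone has no upper bound: the Lipschitz
    constant of \<open>q\<close> is \<open>s\<close> times larger, and
    \<open>s * Y \<le> \<eta>\<close> absorbs this.\<close>
  have lip: "norm (p z - p (of_real \<xi>)) \<le> 24 * Y * norm (z - of_real \<xi>)"
    if z: "z \<in> cball (of_real \<xi>) 1" for z
  proof -
    let ?d = "norm (z - of_real \<xi>)"
    have "p z - p (of_real \<xi>) =
        of_real (- 2) * (of_real \<alpha> * (sin z - sin (of_real \<xi>)) + of_real \<beta> * (cos z - cos (of_real \<xi>)))"
      by (simp add: p_def algebra_simps)
    then have "norm (p z - p (of_real \<xi>)) =
        2 * norm (of_real \<alpha> * (sin z - sin (of_real \<xi>)) + of_real \<beta> * (cos z - cos (of_real \<xi>)))"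
      by (simp only: norm_mult norm_of_real abs_minus_cancel abs_numeral)
    also have "\<dots> \<le> 2 * (\<bar>\<alpha>\<bar> * norm (sin z - sin (of_real \<xi>)) + \<bar>\<beta>\<bar> * norm (cos z - cos (of_real \<xi>)))"
      by (intro mult_left_mono order_trans[OF norm_triangle_ineq]) (auto simp: norm_mult)
    also have "\<dots> \<le> 2 * (2 * Y * (3 * ?d) + 2 * Y * (3 * ?d))"
      using norm_sin_cos_diff_le[OF z] \<alpha>\<beta>
      by (intro mult_left_mono add_mono mult_mono) auto
    finally show ?thesis by simp
  qed
  show ?thesis
  proof (rule phase_factor_real_derivatives[where p = p and q = "\<lambda>z. 1 + of_real s * p z"])
    show "p holomorphic_on UNIV" "(\<lambda>z. 1 + of_real s * p z) holomorphic_on UNIV"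
      unfolding p_def by (intro holomorphic_intros)+
    fix z :: complex
    assume z: "z \<in> cball (of_real \<xi>) 1"
    show "norm (p z - p (of_real \<xi>)) \<le> 24 * norm (z - of_real \<xi>)"
      using Y by (intro order_trans[OF lip[OF z]] mult_right_mono) auto
    have "norm ((1 + of_real s * p z) - (1 + of_real s * p (of_real \<xi>))) =
        s * norm (p z - p (of_real \<xi>))"
      using Y(2) by (simp add: right_diff_distrib[symmetric] norm_mult)
    also have "\<dots> \<le> s * (24 * Y * norm (z - of_real \<xi>))"
      using Y(2) by (intro mult_left_mono lip[OF z]) auto
    also have "\<dots> = 24 * (s * Y) * norm (z - of_real \<xi>)" by simp
    also have "\<dots> \<le> 24 * norm (z - of_real \<xi>)"
      using Y \<eta> by (intro mult_right_mono) auto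
    finally show "norm ((1 + of_real s * p z) - (1 + of_real s * p (of_real \<xi>)))
        \<le> 24 * norm (z - of_real \<xi>)" .
  qed (use \<eta> q0 p0 c f p in auto)
qed

text \<open>\<open>p\<close> is affine and \<open>q\<close> quadratic in \<open>t\<close>, so
  increments are explicit; \<open>s\<close> enters them only through
  \<open>s * Y\<^sup>2 \<le> 1\<close>.\<close>

lemma phase_factor_radial_derivatives:
  fixes b s Y :: real
  defines "P \<equiv> \<lambda>t. t * Y\<^sup>2 - 2 * b"
  assumes \<eta>: "0 < \<eta>" "\<eta> < 1" and q0: "(1 - \<eta>)\<^sup>2 \<le> 1 + s * P s" and p0: "\<bar>P s\<bar> \<le> 24"
    and Y: "0 \<le> Y" "Y \<le> 1" "0 < s" "s * Y \<le> \<eta>" and b: "\<bar>b\<bar> \<le> Y"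
    and c: "0 \<le> c" "c \<le> a"
    and f: "\<And>t. 0 < t \<Longrightarrow> f t = phase_factor c (of_real (P t)) (of_real (1 + t * P t))"
  shows "times_differentiable_at n f s \<and> norm (nth_deriv n f s) \<le> derivative_bound \<eta> n * max (a ^ n) 1"
proof -
  define p :: "complex \<Rightarrow> complex" where "p z = z * of_real (Y\<^sup>2) - 2 * of_real b" for z
  have p: "p (of_real t) = of_real (P t)" for t by (simp add: p_def P_def)
  have Y2: "Y\<^sup>2 \<le> 1" using Y by (simp add: power_le_one)
  have sY2_nonneg: "0 \<le> s * Y\<^sup>2" using Y by simp
  have sY2: "s * Y\<^sup>2 \<le> 1"
    using mult_mono[OF Y(4) Y(2)] Y \<eta> by (simp add: power2_eq_square mult.assoc)
  show ?thesis
  proof (rule phase_factor_real_derivatives[where p = p and q = "\<lambda>z. 1 + z * p z"])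
    show "p holomorphic_on UNIV" "(\<lambda>z. 1 + z * p z) holomorphic_on UNIV"
      unfolding p_def by (intro holomorphic_intros)+
    \<comment> \<open>The formula for \<open>f\<close> is given for positive \<open>t\<close>; the
      open half-line is a neighbourhood of \<open>s\<close>.\<close>
    have "\<forall>\<^sub>F t in nhds s. t \<in> {0<..}"
      using Y by (intro eventually_nhds_in_open) auto
    then show "\<forall>\<^sub>F t in nhds s. f t = phase_factor c (p (of_real t)) (1 + of_real t * p (of_real t))"
      by eventually_elim (simp add: f p)
    fix z :: complex
    assume "z \<in> cball (of_real s) 1"
    then have z: "norm (z - of_real s) \<le> 1" by (simp add: dist_norm norm_minus_commute)
    have "p z - p (of_real s) = (z - of_real s) * of_real (Y\<^sup>2)"
      by (simp add: p_def algebra_simps)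
    then have "norm (p z - p (of_real s)) = norm (z - of_real s) * Y\<^sup>2"
      by (simp add: norm_mult norm_power)
    also have "\<dots> \<le> 24 * norm (z - of_real s)"
      using mult_left_mono[OF Y2, of "norm (z - of_real s)"] norm_ge_zero[of "z - of_real s"]
      by linarith
    finally show "norm (p z - p (of_real s)) \<le> 24 * norm (z - of_real s)" .
    \<comment> \<open>The cofactor of \<open>z - s\<close> in the increment of \<open>q\<close>: its
      first term is at most 4, its second at most 1.\<close>
    let ?w = "of_real (2 * (s * Y\<^sup>2) - 2 * b) + (z - of_real s) * of_real (Y\<^sup>2)"
    have "(1 + z * p z) - (1 + of_real s * p (of_real s)) = (z - of_real s) * ?w"
      by (simp add: p_def algebra_simps)
    then have "norm ((1 + z * p z) - (1 + of_real s * p (of_real s))) = norm (z - of_real s) * norm ?w"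
      by (simp only: norm_mult)
    also have "\<dots> \<le> norm (z - of_real s) * 24"
    proof (rule mult_left_mono)
      have "norm ?w \<le> norm (complex_of_real (2 * (s * Y\<^sup>2) - 2 * b)) + norm ((z - of_real s) * of_real (Y\<^sup>2))"
        by (rule norm_triangle_ineq)
      also have "\<dots> = \<bar>2 * (s * Y\<^sup>2) - 2 * b\<bar> + norm (z - of_real s) * Y\<^sup>2"
        by (simp only: norm_mult norm_of_real) simp
      also have "\<dots> \<le> 4 + 1 * 1"
      proof (intro add_mono mult_mono)
        show "\<bar>2 * (s * Y\<^sup>2) - 2 * b\<bar> \<le> 4" using sY2 sY2_nonneg b Y by linarith
      qed (use z Y2 in auto)
      finally show "norm ?w \<le> 24" by simp
    qed simp
    finally show "norm ((1 + z * p z) - (1 + of_real s * p (of_real s))) \<le> 24 * norm (z - of_real s)"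
      by simp
  qed (use \<eta> q0 p0 c p in auto)
qed

section \<open>The analytic factor in each of the three variables\<close>

lemma analytic_factor_derivatives:
  fixes x' :: "real^3" and n :: nat
  assumes \<kappa>: "0 \<le> \<kappa>" and H: "0 < H" and \<eta>: "0 < \<eta>" "\<eta> < 1" and s: "0 < s"
    and adm: "(sph_point H s \<theta> \<phi>, x') \<in> admissible \<eta> H"
  defines "is_bounded \<equiv> \<lambda>f \<xi>. times_differentiable_at n f \<xi> \<and>
    norm (nth_deriv n f \<xi>) \<le> derivative_bound \<eta> n * max ((\<kappa> * H) ^ n) 1"
  shows "is_bounded (\<lambda>t. analytic_factor \<kappa> (sph_point H t \<theta> \<phi>) x') s"
    and "is_bounded (\<lambda>t. analytic_factor \<kappa> (sph_point H s t \<phi>) x') \<theta>"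
    and "is_bounded (\<lambda>t. analytic_factor \<kappa> (sph_point H s \<theta> t) x') \<phi>"
proof -
  define h where "h = box_radius H"
  have h_eq: "h = sqrt 3 / 2 * H" using H by (simp add: h_def box_radius_eq)
  have h: "0 < h" using H by (simp add: h_eq)
  \<comment> \<open>This gives \<open>h \<le> H\<close>, which allows \<open>\<kappa> * H\<close> to
    replace \<open>\<kappa> * h\<close> in the final bound.\<close>
  have "sqrt 3 \<le> 2" by (rule real_le_lsqrt) auto
  then have "h \<le> H" using H by (simp add: h_eq)
  then have c: "0 \<le> \<kappa> * h" "\<kappa> * h \<le> \<kappa> * H" using \<kappa> h by (auto intro: mult_left_mono)
  \<comment> \<open>In units of \<open>h\<close>, the box gives \<open>Y \<le> 1\<close> and
    admissibility gives \<open>s * Y \<le> \<eta>\<close>.\<close>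
  define y where "y = (1 / h) *\<^sub>R x'"
  define Y where "Y = norm y"
  have x': "x' = h *\<^sub>R y" using h by (simp add: y_def)
  have sph: "sph_point H t \<theta> \<phi> = (h / t) *\<^sub>R unit_direction \<theta> \<phi>" for t \<theta> \<phi>
    by (simp add: sph_point_def unit_direction_def h_def)
  have "norm x' \<le> h"
    using adm norm_source_box_le by (auto simp: admissible_def h_eq)
  then have Y1: "Y \<le> 1" using h by (simp add: Y_def y_def)
  have "norm x' \<le> \<eta> * (h / s)"
    using adm s h by (simp add: admissible_def sph norm_unit_direction)
  then have sY: "s * Y \<le> \<eta>" using h s by (simp add: Y_def y_def field_simps)
  have Y0: "0 \<le> Y" by (simp add: Y_def)
  define e where "e = unit_direction \<theta> \<phi>"
  have e: "norm e = 1" by (simp add: e_def norm_unit_direction)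
  have factor: "analytic_factor \<kappa> (sph_point H t \<theta>' \<phi>') x' = phase_factor (\<kappa> * h)
      (of_real (t * Y\<^sup>2 - 2 * (unit_direction \<theta>' \<phi>' \<bullet> y)))
      (of_real (1 + t * (t * Y\<^sup>2 - 2 * (unit_direction \<theta>' \<phi>' \<bullet> y))))" if "0 < t" for t \<theta>' \<phi>'
    unfolding sph x' Y_def using analytic_factor_scaled(1)[OF norm_unit_direction h that] .
  \<comment> \<open>The reverse triangle inequality bounds from below the vector whose squared
    length is \<open>q\<close> at the centre.\<close>
  have "1 - \<eta> \<le> norm (e - s *\<^sub>R y)"
    using norm_triangle_ineq2[of e "s *\<^sub>R y"] sY s e by (simp add: Y_def)
  then have "(1 - \<eta>)\<^sup>2 \<le> (norm (e - s *\<^sub>R y))\<^sup>2" using \<eta> by (intro power_mono) auto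
  then have q0: "(1 - \<eta>)\<^sup>2 \<le> 1 + s * (s * Y\<^sup>2 - 2 * (e \<bullet> y))"
    unfolding Y_def by (simp only: analytic_factor_scaled(2)[OF e h s])
  have b: "\<bar>e \<bullet> y\<bar> \<le> Y" using Cauchy_Schwarz_ineq2[of e y] e by (simp add: Y_def)
  have sY2: "0 \<le> s * Y\<^sup>2" "s * Y\<^sup>2 \<le> 1"
    using mult_mono[OF sY Y1] Y0 s \<eta> by (auto simp: power2_eq_square mult.assoc)
  have p0: "\<bar>s * Y\<^sup>2 - 2 * (e \<bullet> y)\<bar> \<le> 24"
    using sY2 b Y1 by (auto simp: abs_le_iff)
  show "is_bounded (\<lambda>t. analytic_factor \<kappa> (sph_point H t \<theta> \<phi>) x') s"
    unfolding is_bounded_def using factor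
    by (intro phase_factor_radial_derivatives[OF \<eta> q0 p0 Y0 Y1 s sY b c]) (simp add: e_def)
  have comp: "\<bar>y $ i\<bar> \<le> Y" for i
    unfolding Y_def by (rule component_le_norm_cart)
  have mono: "\<bar>u * y $ i\<bar> \<le> Y" if "\<bar>u\<bar> \<le> 1" for u i
    using mult_mono[OF that comp[of i]] by (simp add: abs_mult)
  define \<alpha> \<beta> where "\<alpha> = cos \<phi> * y $ 1 + sin \<phi> * y $ 2" and "\<beta> = y $ 3"
  \<comment> \<open>The \<open>+ 0\<close> supplies the constant term \<open>\<gamma>\<close> of the
    trigonometric lemma.\<close>
  have ip: "unit_direction t \<phi> \<bullet> y = \<alpha> * sin t + \<beta> * cos t + 0" for t
    by (simp add: inner_unit_direction \<alpha>_def \<beta>_def algebra_simps)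
  have \<alpha>\<beta>: "\<bar>\<alpha>\<bar> \<le> 2 * Y" "\<bar>\<beta>\<bar> \<le> 2 * Y"
    using mono[of "cos \<phi>" 1] mono[of "sin \<phi>" 2] comp[of 3] Y0 by (auto simp: \<alpha>_def \<beta>_def)
  show "is_bounded (\<lambda>t. analytic_factor \<kappa> (sph_point H s t \<phi>) x') \<theta>"
    unfolding is_bounded_def
    by (rule phase_factor_trig_derivatives[OF \<eta> _ _ Y1 s sY \<alpha>\<beta> c])
      (use q0 p0 factor[OF s] in \<open>simp_all only: e_def ip\<close>)
  \<comment> \<open>The third coordinate of the direction does not depend on the azimuth and becomes
    the constant term.\<close>
  define \<alpha>' \<beta>' \<gamma> where "\<alpha>' = sin \<theta> * y $ 2" and "\<beta>' = sin \<theta> * y $ 1" and "\<gamma> = cos \<theta> * y $ 3"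
  have ip': "unit_direction \<theta> t \<bullet> y = \<alpha>' * sin t + \<beta>' * cos t + \<gamma>" for t
    by (simp add: inner_unit_direction \<alpha>'_def \<beta>'_def \<gamma>_def algebra_simps)
  have \<alpha>\<beta>': "\<bar>\<alpha>'\<bar> \<le> 2 * Y" "\<bar>\<beta>'\<bar> \<le> 2 * Y"
    using mono[of "sin \<theta>" 2] mono[of "sin \<theta>" 1] Y0 by (auto simp: \<alpha>'_def \<beta>'_def)
  show "is_bounded (\<lambda>t. analytic_factor \<kappa> (sph_point H s \<theta> t) x') \<phi>"
    unfolding is_bounded_def
    by (rule phase_factor_trig_derivatives[OF \<eta> _ _ Y1 s sY \<alpha>\<beta>' c])
      (use q0 p0 factor[OF s] in \<open>simp_all only: e_def ip'\<close>)
qed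

theorem theorem2:
  "\<exists>M :: real \<Rightarrow> nat \<Rightarrow> real.
     \<forall>\<kappa> H \<eta> :: real. 0 \<le> \<kappa> \<longrightarrow> 0 < H \<longrightarrow> 0 < \<eta> \<longrightarrow> \<eta> < 1 \<longrightarrow>
       (\<forall>x x' :: real^3. \<forall>s \<theta> \<phi> :: real. \<forall>n :: nat.
          (x, x') \<in> admissible \<eta> H \<longrightarrow> 0 < s \<longrightarrow> x = sph_point H s \<theta> \<phi> \<longrightarrow>
          (\<forall>(f, \<xi>) \<in> {(\<lambda>t. analytic_factor \<kappa> (sph_point H t \<theta> \<phi>) x', s),
                      (\<lambda>t. analytic_factor \<kappa> (sph_point H s t \<phi>) x', \<theta>),
                      (\<lambda>t. analytic_factor \<kappa> (sph_point H s \<theta> t) x', \<phi>)}.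
             times_differentiable_at n f \<xi> \<and>
             norm (nth_deriv n f \<xi>) \<le> M \<eta> n * max ((\<kappa> * H) ^ n) 1))"
  \<comment> \<open>The witness takes only \<open>\<eta>\<close> and \<open>n\<close> as arguments,
    hence is independent of \<open>\<kappa>\<close>, \<open>H\<close> and the points.\<close>
  by (intro exI[of _ derivative_bound] allI impI) (simp add: analytic_factor_derivatives)

end
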